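(* Let $f(\boldsymbol\alpha)=l(A\boldsymbol\alpha)+\mathbf c^\top\boldsymbol\alpha$ with $A\in\mathbb{R}^{d\times n}$ having columns $\mathbf A_1,\dots,\mathbf A_n\in\mathbb{R}^d$, $\mathbf c\in\mathbb{R}^n$ and $l:\mathbb{R}^d\to\mathbb{R}$ convex and differentiable, and let $\beta>0$. For any iterate $\boldsymbol\alpha^{(t)}\in[0,1]^n$, with the point set $\mathcal P$, the subset $\mathcal B_t\subseteq\mathcal P$, the query vector $\mathbf q_t$ and the active set $\mathcal A_t$ defined in the context, $$\operatorname{S-MIPS}_{\mathcal P}(\mathbf q_t;\mathcal B_t)=\arg\max_{j\in\mathcal A_t}\big|\nabla_j f(\boldsymbol\alpha^{(t)})\big|,$$ where a vector $\pm\tilde{\mathbf A}_j\in\mathcal B_t$ returned by the left-hand side is identified with its coordinate index $j$.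
   Context: Vectors in $\mathbb{R}^{d+1}$: $\tilde{\mathbf A}_j=(\beta c_j,\ \mathbf A_j)^\top$ for $j\in[n]$; $\mathcal P=\{\tilde{\mathbf A}_1,\dots,\tilde{\mathbf A}_n\}\cup\{-\tilde{\mathbf A}_1,\dots,-\tilde{\mathbf A}_n\}$. Query: $\mathbf q_t=\big(\tfrac1\beta,\ \nabla l(A\boldsymbol\alpha^{(t)})\big)^\top$. Subset: $\mathcal B_t=\{\tilde{\mathbf A}_j:\alpha_j^{(t)}>0\}\cup\{-\tilde{\mathbf A}_j:\alpha_j^{(t)}<1\}$. Active set: $\mathcal A_t$ is the set of $i\in[n]$ such that $\alpha_i^{(t)}\in(0,1)$, or $\alpha_i^{(t)}=0$ and $\nabla_i f(\boldsymbol\alpha^{(t)})<0$, or $\alpha_i^{(t)}=1$ and $\nabla_i f(\boldsymbol\alpha^{(t)})>0$. Subset maximum inner product search: $\operatorname{S-MIPS}_{\mathcal P}(\mathbf q;\mathcal B)=\arg\max_{\mathbf p\in\mathcal B}\langle\mathbf p,\mathbf q\rangle$. Here $\arg\max$ denotes a maximizing element, with ties broken arbitrarily.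
   Formalization: Equality is proved if α^(t) does not minimize f on [0,1]^n; at minimizers it can fail (l=0, c=0, α=(1/2,0): index 2 may be returned, A_t={1}). For every iterate, returned indices in A_t are exactly the maximizers, and if A_t is nonempty all returned indices attain the maximum. *)

theory Defs
  imports "HOL-Analysis.Analysis"
begin

definition gradient :: "('a::real_inner \<Rightarrow> real) \<Rightarrow> 'a \<Rightarrow> 'a" where
  "gradient g x = (THE D. GDERIV g x :> D)"

lemma gradient_eqI: "GDERIV g x :> D \<Longrightarrow> gradient g x = D"
  unfolding gradient_def
proof (rule the_equality)
  fix D' assume "GDERIV g x :> D" "GDERIV g x :> D'"
  then have "(\<lambda>h. h \<bullet> D) = (\<lambda>h. h \<bullet> D')"
    unfolding gderiv_def by (rule has_derivative_unique)
  then show "D' = D"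
    by (metis inner_commute vector_eq_rdot)
qed

definition objective :: "(real^'d \<Rightarrow> real) \<Rightarrow> real^'n^'d \<Rightarrow> real^'n \<Rightarrow> real^'n \<Rightarrow> real" where
  "objective l A c \<alpha> = l (A *v \<alpha>) + c \<bullet> \<alpha>"

text \<open>The augmented space of dimension \<open>d + 1\<close> is the product \<open>real \<times> real^'d\<close> with its
  Euclidean inner product.\<close>

definition aug_col :: "real^'n^'d \<Rightarrow> real^'n \<Rightarrow> real \<Rightarrow> 'n \<Rightarrow> real \<times> (real^'d)" where
  "aug_col A c \<beta> j = (\<beta> * c $ j, column j A)"

definition point_set :: "real^'n^'d \<Rightarrow> real^'n \<Rightarrow> real \<Rightarrow> (real \<times> (real^'d)) set" where
  "point_set A c \<beta> = range (aug_col A c \<beta>) \<union> range (\<lambda>j. - aug_col A c \<beta> j)"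

definition query ::
  "(real^'d \<Rightarrow> real) \<Rightarrow> real^'n^'d \<Rightarrow> real \<Rightarrow> real^'n \<Rightarrow> real \<times> (real^'d)" where
  "query l A \<beta> \<alpha> = (1 / \<beta>, gradient l (A *v \<alpha>))"

definition search_set ::
  "real^'n^'d \<Rightarrow> real^'n \<Rightarrow> real \<Rightarrow> real^'n \<Rightarrow> (real \<times> (real^'d)) set" where
  "search_set A c \<beta> \<alpha> =
     {aug_col A c \<beta> j | j. \<alpha> $ j > 0} \<union> {- aug_col A c \<beta> j | j. \<alpha> $ j < 1}"

lemma search_set_subset_point_set: "search_set A c \<beta> \<alpha> \<subseteq> point_set A c \<beta>"
  by (auto simp: search_set_def point_set_def)

definition active_set :: "(real^'n \<Rightarrow> real) \<Rightarrow> real^'n \<Rightarrow> 'n set" where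
  "active_set f \<alpha> =
     {i. \<alpha> $ i \<in> {0<..<1}
       \<or> (\<alpha> $ i = 0 \<and> gradient f \<alpha> $ i < 0)
       \<or> (\<alpha> $ i = 1 \<and> gradient f \<alpha> $ i > 0)}"

text \<open>An arg max with arbitrary tie-breaking is represented by the set of all its possible
  values; it is empty if \<open>S\<close> is. For the active set this happens only at minimisers of the
  objective over the unit box. At a minimiser the
  search may also return an inactive coordinate, so there the two index sets need only agree
  after intersecting with the active
  set.\<close>

definition argmax_set :: "('a \<Rightarrow> real) \<Rightarrow> 'a set \<Rightarrow> 'a set" where
  "argmax_set g S = {x. is_arg_max g (\<lambda>y. y \<in> S) x}"

text \<open>The ambient point set \<open>P\<close> is only a label: a search is meaningful for \<open>B \<subseteq> P\<close> and then
  maximises over \<open>B\<close>.\<close>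

definition smips :: "'a::real_inner set \<Rightarrow> 'a \<Rightarrow> 'a set \<Rightarrow> 'a set" where
  "smips P q B = argmax_set (\<lambda>p. p \<bullet> q) B"

text \<open>The coordinate indices of a returned vector. Different \<open>j\<close> may give the same vector
  (e.g. for repeated columns), so \<open>p = \<plusminus> aug_col j\<close> alone is not enough: \<open>j\<close> must be an index
  through which \<open>p\<close>, with that sign, is a member of the search set.\<close>

definition coord_indices ::
  "real^'n^'d \<Rightarrow> real^'n \<Rightarrow> real \<Rightarrow> real^'n \<Rightarrow> real \<times> (real^'d) \<Rightarrow> 'n set" where
  "coord_indices A c \<beta> \<alpha> p =
     {j. (p = aug_col A c \<beta> j \<and> \<alpha> $ j > 0) \<or> (p = - aug_col A c \<beta> j \<and> \<alpha> $ j < 1)}"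

end

(* The inner product of the query with \<plusminus>aug_col j is \<plusminus>\<nabla>_j f. A coordinate of \<alpha> strictly inside
   (0, 1) contributes both signs to the search set, one on the boundary only the sign whose score is
   positive exactly when the coordinate is active. Hence the search maximises |\<nabla>_j f| over the active
   coordinates as soon as its value is positive, and if no active coordinate has a nonzero
   derivative then \<alpha> satisfies the first-order conditions and is a minimiser by convexity. *)
theory Submission
  imports Defs
begin

text \<open>The derivative is a linear functional \<open>L\<close>, and the adjoint identity
  represents it by the vector \<open>adjoint L 1\<close>. Uniqueness of gradients identifies that
  vector with \<open>gradient l x\<close>.\<close>

lemma differentiable_imp_GDERIV_gradient:
  fixes l :: "'a::euclidean_space \<Rightarrow> real"
  assumes "l differentiable (at x)"
  shows "GDERIV l x :> gradient l x"
proof -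
  obtain L where L: "(l has_derivative L) (at x)"
    using assms by (auto simp: differentiable_def)
  then have lin: "linear L"
    by (rule has_derivative_linear)
  have "L h = h \<bullet> adjoint L 1" for h
    using adjoint_works[OF lin, of h 1] by simp
  then have "L = (\<lambda>h. h \<bullet> adjoint L 1)" by auto
  with L have "GDERIV l x :> adjoint L 1"
    unfolding gderiv_def by simp
  then show ?thesis
    using gradient_eqI by metis
qed

text \<open>Restricting \<open>l\<close> to the line through \<open>x\<close> and \<open>y\<close>
  leaves a convex function of one real variable with slope \<open>(y - x) \<bullet> D\<close> at 0.
  Its tangent at 0, evaluated at 1, gives the bound.\<close>

lemma convex_on_above_tangent_GDERIV:
  fixes l :: "'a::real_inner \<Rightarrow> real"
  assumes "convex_on UNIV l" and D: "GDERIV l x :> D"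
  shows "l y \<ge> l x + (y - x) \<bullet> D"
proof -
  let ?\<gamma> = "\<lambda>t::real. x + t *\<^sub>R (y - x)"
  have conv: "convex_on UNIV (\<lambda>t. l (?\<gamma> t))"
  proof (rule convex_onI)
    fix t a b :: real
    assume t: "0 < t" "t < 1"
    have "?\<gamma> ((1 - t) *\<^sub>R a + t *\<^sub>R b) = (1 - t) *\<^sub>R ?\<gamma> a + t *\<^sub>R ?\<gamma> b"
      by (simp add: algebra_simps)
    then show "l (?\<gamma> ((1 - t) *\<^sub>R a + t *\<^sub>R b)) \<le> (1 - t) * l (?\<gamma> a) + t * l (?\<gamma> b)"
      using convex_onD[OF assms(1), of t "?\<gamma> a" "?\<gamma> b"] t by simp
  qed simp
  have "(?\<gamma> has_derivative (\<lambda>h. h *\<^sub>R (y - x))) (at 0)"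
    by (auto intro!: derivative_eq_intros)
  moreover have "(l has_derivative (\<lambda>h. h \<bullet> D)) (at (?\<gamma> 0))"
    using D by (simp add: gderiv_def)
  ultimately have "((\<lambda>t. l (?\<gamma> t)) has_derivative (\<lambda>h. (h *\<^sub>R (y - x)) \<bullet> D)) (at 0)"
    by (rule has_derivative_compose)
  then have "((\<lambda>t. l (?\<gamma> t)) has_real_derivative (y - x) \<bullet> D) (at 0)"
    by (simp add: has_field_derivative_def mult_commute_abs)
  from convex_on_imp_above_tangent[OF conv _ _ _ this, of 1]
  show ?thesis by simp
qed

lemma gradient_objective:
  fixes l :: "real^'d \<Rightarrow> real" and A :: "real^'n^'d"
  assumes "l differentiable (at (A *v \<alpha>))"
  shows "gradient (objective l A c) \<alpha> = c + gradient l (A *v \<alpha>) v* A"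
proof (rule gradient_eqI)
  let ?D = "gradient l (A *v \<alpha>)"
  have "((\<lambda>x. A *v x) has_derivative (\<lambda>h. A *v h)) (at \<alpha>)"
    by (rule linear_imp_has_derivative) simp
  moreover have "(l has_derivative (\<lambda>h. h \<bullet> ?D)) (at (A *v \<alpha>))"
    using differentiable_imp_GDERIV_gradient[OF assms] by (simp add: gderiv_def)
  ultimately have "((\<lambda>x. l (A *v x)) has_derivative (\<lambda>h. (A *v h) \<bullet> ?D)) (at \<alpha>)"
    by (rule has_derivative_compose)
  then have "((\<lambda>x. l (A *v x) + c \<bullet> x) has_derivative (\<lambda>h. (A *v h) \<bullet> ?D + c \<bullet> h)) (at \<alpha>)"
    by (auto intro!: derivative_eq_intros)
  moreover have "(A *v h) \<bullet> ?D + c \<bullet> h = h \<bullet> (c + ?D v* A)" for h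
    by (simp add: inner_add_right inner_commute[of h] inner_commute[of "A *v h"] dot_lmul_matrix)
  ultimately show "GDERIV (objective l A c) \<alpha> :> c + ?D v* A"
    by (simp add: gderiv_def objective_def[abs_def])
qed

text \<open>The factors \<open>\<beta>\<close> and \<open>1 / \<beta>\<close> cancel in the first
  component, and the second gives the j-th entry of
  \<open>gradient l (A *v \<alpha>) v* A\<close>.\<close>

lemma inner_aug_col_query:
  assumes "l differentiable (at (A *v \<alpha>))" "\<beta> > 0"
  shows "aug_col A c \<beta> j \<bullet> query l A \<beta> \<alpha> = gradient (objective l A c) \<alpha> $ j"
  using assms
  by (simp add: gradient_objective aug_col_def query_def inner_vec_def column_def
      vector_matrix_mult_def mult.commute)

text \<open>The tangent inequality for \<open>l\<close> at \<open>A *v \<alpha>\<close> is pulled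
  back along \<open>A\<close>; the linear term agrees with its own tangent.\<close>

lemma objective_above_tangent:
  assumes "convex_on UNIV l" "l differentiable (at (A *v \<alpha>))"
  shows "objective l A c y \<ge> objective l A c \<alpha> + (y - \<alpha>) \<bullet> gradient (objective l A c) \<alpha>"
proof -
  let ?D = "gradient l (A *v \<alpha>)"
  have "l (A *v y) \<ge> l (A *v \<alpha>) + (A *v y - A *v \<alpha>) \<bullet> ?D"
    by (rule convex_on_above_tangent_GDERIV[OF assms(1)
          differentiable_imp_GDERIV_gradient[OF assms(2)]])
  moreover have "(y - \<alpha>) \<bullet> (c + ?D v* A) = (A *v y - A *v \<alpha>) \<bullet> ?D + c \<bullet> y - c \<bullet> \<alpha>"
    by (simp add: inner_commute[of "y - \<alpha>"] inner_commute[of "A *v y - A *v \<alpha>"] inner_add_left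
        inner_diff_right dot_lmul_matrix)
  ultimately show ?thesis
    by (simp add: gradient_objective[OF assms(2)] objective_def)
qed

text \<open>At an inactive coordinate the derivative does not decrease towards the inside of the
  box, and at an active one it vanishes. So each summand of
  \<open>(y - \<alpha>) \<bullet> ?g\<close> is nonnegative, and the tangent inequality
  concludes.\<close>

lemma is_arg_min_objective_if_active_zero:
  assumes conv: "convex_on UNIV l" and diff: "l differentiable (at (A *v \<alpha>))"
    and box: "\<alpha> \<in> cbox 0 1"
    and zero: "\<And>j. j \<in> active_set (objective l A c) \<alpha> \<Longrightarrow> gradient (objective l A c) \<alpha> $ j = 0"
  shows "is_arg_min (objective l A c) (\<lambda>x. x \<in> cbox 0 1) \<alpha>"
proof -
  let ?g = "gradient (objective l A c) \<alpha>"
  have "0 \<le> (y - \<alpha>) \<bullet> ?g" if y: "y \<in> cbox 0 1" for y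
  proof -
    have "0 \<le> (y $ j - \<alpha> $ j) * ?g $ j" for j
    proof -
      have bounds: "0 \<le> \<alpha> $ j" "\<alpha> $ j \<le> 1" "0 \<le> y $ j" "y $ j \<le> 1"
        using box y by (auto simp: mem_box_cart)
      have "0 < \<alpha> $ j \<Longrightarrow> \<alpha> $ j < 1 \<Longrightarrow> ?g $ j = 0"
        and lower: "\<alpha> $ j = 0 \<Longrightarrow> 0 \<le> ?g $ j" and upper: "\<alpha> $ j = 1 \<Longrightarrow> ?g $ j \<le> 0"
        using zero[of j] unfolding active_set_def by (auto simp: not_less[symmetric])
      then consider "\<alpha> $ j = 0" | "\<alpha> $ j = 1" | "?g $ j = 0"
        using bounds(1,2) by linarith
      then show ?thesis
        using bounds(3,4) lower upper by cases (simp_all add: mult_nonpos_nonpos)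
    qed
    then show ?thesis
      by (simp add: inner_vec_def sum_nonneg)
  qed
  then have "objective l A c \<alpha> \<le> objective l A c y" if "y \<in> cbox 0 1" for y
    using objective_above_tangent[OF conv diff, of c y] that by fastforce
  then show ?thesis
    using box unfolding is_arg_min_linorder by blast
qed

text \<open>This removes the vectors from the search: \<open>dominates v\<close> says that
  \<open>v\<close> bounds every score in the search set, and the two disjuncts are the two signs
  with which \<open>j\<close> can be returned.\<close>

lemma coord_indices_smips:
  fixes l :: "real^'d \<Rightarrow> real" and A :: "real^'n^'d" and c :: "real^'n"
  assumes diff: "l differentiable (at (A *v \<alpha>))" and "\<beta> > 0"
  defines "g \<equiv> gradient (objective l A c) \<alpha>"
  defines "dominates \<equiv> \<lambda>v. \<forall>k. (\<alpha> $ k > 0 \<longrightarrow> g $ k \<le> v) \<and> (\<alpha> $ k < 1 \<longrightarrow> - g $ k \<le> v)"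
  shows "j \<in> (\<Union>p \<in> smips (point_set A c \<beta>) (query l A \<beta> \<alpha>) (search_set A c \<beta> \<alpha>).
              coord_indices A c \<beta> \<alpha> p)
    \<longleftrightarrow> (\<alpha> $ j > 0 \<and> dominates (g $ j)) \<or> (\<alpha> $ j < 1 \<and> dominates (- g $ j))"
proof -
  let ?q = "query l A \<beta> \<alpha>"
  have q: "aug_col A c \<beta> k \<bullet> ?q = g $ k" for k
    unfolding g_def by (rule inner_aug_col_query) fact+
  have "dominates v \<longleftrightarrow> (\<forall>p \<in> search_set A c \<beta> \<alpha>. p \<bullet> ?q \<le> v)" for v
  proof -
    have "(\<forall>p \<in> search_set A c \<beta> \<alpha>. p \<bullet> ?q \<le> v)
      \<longleftrightarrow> (\<forall>k. \<alpha> $ k > 0 \<longrightarrow> aug_col A c \<beta> k \<bullet> ?q \<le> v)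
        \<and> (\<forall>k. \<alpha> $ k < 1 \<longrightarrow> (- aug_col A c \<beta> k) \<bullet> ?q \<le> v)"
      unfolding search_set_def by blast
    then show ?thesis
      unfolding dominates_def inner_minus_left q by blast
  qed
  then have smips: "p \<in> smips (point_set A c \<beta>) ?q (search_set A c \<beta> \<alpha>)
      \<longleftrightarrow> p \<in> search_set A c \<beta> \<alpha> \<and> dominates (p \<bullet> ?q)" for p
    unfolding smips_def argmax_set_def is_arg_max_linorder mem_Collect_eq by blast
  show ?thesis
  proof -
    have "j \<in> (\<Union>p \<in> smips (point_set A c \<beta>) ?q (search_set A c \<beta> \<alpha>). coord_indices A c \<beta> \<alpha> p)
      \<longleftrightarrow> (\<alpha> $ j > 0 \<and> dominates (aug_col A c \<beta> j \<bullet> ?q))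
        \<or> (\<alpha> $ j < 1 \<and> dominates ((- aug_col A c \<beta> j) \<bullet> ?q))"
      \<comment> \<open>The bound variable \<open>p\<close> is one of the two signed columns of
        \<open>j\<close>, and the condition on \<open>\<alpha> $ j\<close> in
        \<open>coord_indices\<close> already places it in the search set.\<close>
      unfolding UN_iff Bex_def smips
      unfolding coord_indices_def search_set_def Un_iff mem_Collect_eq by metis
    then show ?thesis
      unfolding inner_minus_left q .
  qed
qed

text \<open>The last conjunct covers the tie at a minimiser: an inactive index returned there has
  derivative 0, as do all active ones, so the maximal value is still attained.\<close>

theorem lemma6:
  fixes l :: "real^'d \<Rightarrow> real"
    and A :: "real^'n^'d"
    and c :: "real^'n"
    and \<beta> :: real
    and \<alpha> :: "real^'n"
  defines "f \<equiv> objective l A c"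
  defines "act \<equiv> active_set f \<alpha>"
  defines "lhs \<equiv> (\<Union>p \<in> smips (point_set A c \<beta>) (query l A \<beta> \<alpha>) (search_set A c \<beta> \<alpha>).
                    coord_indices A c \<beta> \<alpha> p)"
  defines "rhs \<equiv> argmax_set (\<lambda>j. \<bar>gradient f \<alpha> $ j\<bar>) act"
  assumes "convex_on UNIV l"
    and "\<And>x. l differentiable (at x)"
    and "\<beta> > 0"
    and "\<alpha> \<in> cbox 0 1"
  shows "(\<not> is_arg_min f (\<lambda>x. x \<in> cbox 0 1) \<alpha> \<longrightarrow> rhs \<noteq> {} \<and> lhs = rhs)
       \<and> lhs \<inter> act = rhs
       \<and> (act \<noteq> {} \<longrightarrow> lhs \<noteq> {} \<and>
            (\<forall>j\<in>lhs. \<bar>gradient f \<alpha> $ j\<bar> = Max ((\<lambda>i. \<bar>gradient f \<alpha> $ i\<bar>) ` act)))"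
proof -
  define g where "g = gradient f \<alpha>"
  define dominates where
    "dominates v \<longleftrightarrow> (\<forall>k. (\<alpha> $ k > 0 \<longrightarrow> g $ k \<le> v) \<and> (\<alpha> $ k < 1 \<longrightarrow> - g $ k \<le> v))" for v
  have lhs: "j \<in> lhs \<longleftrightarrow> (\<alpha> $ j > 0 \<and> dominates (g $ j)) \<or> (\<alpha> $ j < 1 \<and> dominates (- g $ j))"
    for j
    using coord_indices_smips[OF assms(6,7), where j = j]
    unfolding lhs_def dominates_def g_def f_def .
  have rhs: "j \<in> rhs \<longleftrightarrow> j \<in> act \<and> (\<forall>k\<in>act. \<bar>g $ k\<bar> \<le> \<bar>g $ j\<bar>)" for j
    by (auto simp: rhs_def argmax_set_def is_arg_max_linorder g_def)
  have box: "0 \<le> \<alpha> $ j" "\<alpha> $ j \<le> 1" for j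
    using assms(8) by (auto simp: mem_box_cart)
  have act: "j \<in> act \<longleftrightarrow> 0 < \<alpha> $ j \<and> \<alpha> $ j < 1 \<or> \<alpha> $ j = 0 \<and> g $ j < 0 \<or> \<alpha> $ j = 1 \<and> g $ j > 0"
    for j
    by (auto simp: act_def active_set_def g_def)
  \<comment> \<open>An interior coordinate offers both signs; at an active boundary coordinate the
    single available score is already the absolute value.\<close>
  have dominates_act: "\<bar>g $ k\<bar> \<le> v" if "dominates v" "k \<in> act" for v k
  proof -
    have "\<alpha> $ k > 0 \<Longrightarrow> g $ k \<le> v" "\<alpha> $ k < 1 \<Longrightarrow> - g $ k \<le> v"
      using that(1) unfolding dominates_def by blast+
    then show ?thesis
      using that(2) unfolding act by (auto simp: abs_if)
  qed
  have lhs_cases: "\<bar>g $ k\<bar> \<le> g $ j \<and> \<alpha> $ j > 0 \<or> \<bar>g $ k\<bar> \<le> - g $ j \<and> \<alpha> $ j < 1"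
    if "j \<in> lhs" "k \<in> act" for j k
    using that(1) dominates_act[OF _ that(2)] unfolding lhs by blast
  have lhs_bound: "\<bar>g $ k\<bar> \<le> \<bar>g $ j\<bar>" if "j \<in> lhs" "k \<in> act" for j k
    using lhs_cases[OF that] by linarith
  \<comment> \<open>The active \<open>k\<close> forces the score of \<open>j\<close> to be
    nonnegative, hence positive as \<open>g $ j\<close> is nonzero. A boundary coordinate with a
    positive available score is active.\<close>
  have lhs_act: "j \<in> act" if "j \<in> lhs" "k \<in> act" "g $ j \<noteq> 0" for j k
    using lhs_cases[OF that(1,2)] that(3) box[of j] unfolding act[of j] by linarith
  have rhs_lhs: "j \<in> lhs" if "j \<in> rhs" for j
  proof -
    have *: "j \<in> act" "\<And>k. k \<in> act \<Longrightarrow> \<bar>g $ k\<bar> \<le> \<bar>g $ j\<bar>"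
      using that by (auto simp: rhs)
    \<comment> \<open>Scores of active coordinates are bounded by the choice of \<open>j\<close>;
      those of inactive ones are at most 0.\<close>
    have "dominates \<bar>g $ j\<bar>"
      unfolding dominates_def
    proof (intro allI conjI impI)
      fix k
      show "g $ k \<le> \<bar>g $ j\<bar>" if "\<alpha> $ k > 0"
        using *(2)[of k] that box[of k] unfolding act by linarith
      show "- g $ k \<le> \<bar>g $ j\<bar>" if "\<alpha> $ k < 1"
        using *(2)[of k] that box[of k] unfolding act by linarith
    qed
    then show ?thesis
      using *(1) unfolding lhs act by (auto simp: abs_if split: if_splits)
  qed
  have inter: "lhs \<inter> act = rhs"
    using lhs_bound rhs_lhs by (auto simp: rhs)
  have rhs_nonempty: "rhs \<noteq> {}" if "act \<noteq> {}"
  proof -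
    have "Max ((\<lambda>i. \<bar>g $ i\<bar>) ` act) \<in> (\<lambda>i. \<bar>g $ i\<bar>) ` act"
      using that by (intro Max_in) auto
    then obtain j where "j \<in> act" "\<bar>g $ j\<bar> = Max ((\<lambda>i. \<bar>g $ i\<bar>) ` act)"
      by auto
    then have "j \<in> rhs"
      unfolding rhs by simp
    then show ?thesis by blast
  qed
  have "rhs \<noteq> {} \<and> lhs = rhs" if "\<not> is_arg_min f (\<lambda>x. x \<in> cbox 0 1) \<alpha>"
  proof -
    \<comment> \<open>Otherwise the first-order conditions would make \<alpha> a minimiser.\<close>
    have "\<exists>k\<in>act. g $ k \<noteq> 0"
    proof (rule ccontr)
      assume "\<not> (\<exists>k\<in>act. g $ k \<noteq> 0)"
      then have "gradient f \<alpha> $ k = 0" if "k \<in> active_set f \<alpha>" for k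
        using that unfolding act_def g_def by blast
      then have "is_arg_min f (\<lambda>x. x \<in> cbox 0 1) \<alpha>"
        unfolding f_def by (rule is_arg_min_objective_if_active_zero[OF assms(5,6,8)])
      with that show False ..
    qed
    then obtain k where k: "k \<in> act" "g $ k \<noteq> 0" ..
    \<comment> \<open>A returned index has absolute derivative at least that of \<open>k\<close>,
      which is positive, so \<open>lhs_act\<close> applies.\<close>
    have "j \<in> act" if "j \<in> lhs" for j
      using lhs_act[OF that k(1)] lhs_bound[OF that k(1)] k(2) by fastforce
    then show ?thesis
      using inter rhs_nonempty k(1) by blast
  qed
  moreover have "\<bar>g $ j\<bar> = Max ((\<lambda>i. \<bar>g $ i\<bar>) ` act)" if "act \<noteq> {}" "j \<in> lhs" for j
  proof (rule antisym)
    from that(1) obtain k where k: "k \<in> act" by blast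
    \<comment> \<open>An active \<open>j\<close> is its own witness; an inactive one has derivative
      0, so any active \<open>k\<close> serves.\<close>
    have "\<exists>i\<in>act. \<bar>g $ j\<bar> \<le> \<bar>g $ i\<bar>"
    proof (cases "j \<in> act")
      case False
      then have "g $ j = 0"
        using lhs_act[OF that(2) k] by blast
      then show ?thesis using k by auto
    qed auto
    then show "\<bar>g $ j\<bar> \<le> Max ((\<lambda>i. \<bar>g $ i\<bar>) ` act)"
      by (subst Max_ge_iff) auto
    show "Max ((\<lambda>i. \<bar>g $ i\<bar>) ` act) \<le> \<bar>g $ j\<bar>"
      using that lhs_bound by simp
  qed
  ultimately show ?thesis
    using inter rhs_nonempty rhs_lhs unfolding g_def by blast
qed

end
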